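(* For every natural number $n\geq 2$, \[ \varphi^3(n)+\psi^3(n)+\sigma^3(n)\geq 3n^3+3n^2+9n+1. \]
   Context: For a natural number $n$, $\varphi(n)$ is Euler's totient function (the number of positive integers not exceeding $n$ that are coprime to $n$). For $n=p_1^{a_1}\cdots p_k^{a_k}$ (distinct primes $p_i$, $a_i\geq1$), the Dedekind function is $\psi(n)=\prod_{i=1}^k p_i^{a_i-1}(p_i+1)$, with $\psi(1)=1$. $\sigma(n)$ denotes the sum of the positive divisors of $n$. *)

theory Defs
  imports "HOL-Number_Theory.Number_Theory"
begin

(* Natural-number subtraction is exact here: multiplicity p n >= 1 for each prime factor p of n. *)
definition dedekind_psi :: "nat \<Rightarrow> nat" where
  "dedekind_psi n = (\<Prod>p\<in>prime_factors n. p ^ (multiplicity p n - 1) * (p + 1))"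

(* For n = 0 the index set is infinite, so divisor_sum 0 = 0 by the convention for sum. *)
definition divisor_sum :: "nat \<Rightarrow> nat" where
  "divisor_sum n = (\<Sum>d | d dvd n. d)"

end

(* Put s = psi(n) - n. Then s >= 1, sigma(n) >= psi(n) = n + s, and phi(n) + psi(n) >= 2n gives
   phi(n) >= n - s. Hence the sum of cubes is at least
   (n - s)^3 + 2 (n + s)^3 = 3 n^3 + 3 n^2 s + 9 n s^2 + s^3, which is increasing in s and equals
   the right-hand side at s = 1. *)
theory Submission
  imports Defs
begin

text \<open>With \<open>?M\<close> and \<open>?P\<close> the two products over \<open>A\<close>,
  inserting \<open>a\<close> raises their sum by \<open>f a * (?P - ?M)\<close>, which is
  nonnegative. The case of interest is f(p) = 1/p over the primes dividing n.\<close>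

lemma prod_one_minus_plus_prod_one_plus_ge:
  fixes f :: "'a \<Rightarrow> real"
  assumes "finite A" "\<And>x. x \<in> A \<Longrightarrow> 0 \<le> f x \<and> f x \<le> 1"
  shows "(\<Prod>x\<in>A. 1 - f x) + (\<Prod>x\<in>A. 1 + f x) \<ge> 2"
  using assms
proof (induction A rule: finite_induct)
  case (insert a A)
  let ?M = "\<Prod>x\<in>A. 1 - f x" and ?P = "\<Prod>x\<in>A. 1 + f x"
  \<comment> \<open>The bound f(x) <= 1 keeps the factors of \<open>?M\<close> nonnegative, so the
    products compare factor by factor.\<close>
  have "?M \<le> ?P"
    using insert.prems by (intro prod_mono) fastforce
  hence "0 \<le> f a * (?P - ?M)"
    using insert.prems by simp
  moreover have "?M + ?P \<ge> 2"
    using insert by simp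
  moreover have "(1 - f a) * ?M + (1 + f a) * ?P = ?M + ?P + f a * (?P - ?M)"
    by (simp add: algebra_simps)
  ultimately show ?case
    using insert.hyps by simp
qed simp

text \<open>Gives psi the same shape as Euler's product for phi, so that the two can be added with
  the common factor n.\<close>

lemma dedekind_psi_real:
  assumes "n > 0"
  shows "real (dedekind_psi n) = real n * (\<Prod>p\<in>prime_factors n. 1 + 1 / real p)"
proof -
  have "real (dedekind_psi n) =
      (\<Prod>p\<in>prime_factors n. real (p ^ multiplicity p n) * (1 + 1 / real p))"
    unfolding dedekind_psi_def of_nat_prod
  proof (rule prod.cong)
    fix p assume p: "p \<in> prime_factors n"
    hence "p > 0" "multiplicity p n > 0"
      by (auto simp: prime_factors_multiplicity prime_gt_0_nat)
    then show "real (p ^ (multiplicity p n - 1) * (p + 1)) =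
        real (p ^ multiplicity p n) * (1 + 1 / real p)"
      by (cases "multiplicity p n") (auto simp: field_simps)
  qed simp
  also have "\<dots> = real (\<Prod>p\<in>prime_factors n. p ^ multiplicity p n) *
      (\<Prod>p\<in>prime_factors n. 1 + 1 / real p)"
    by (simp add: prod.distrib)
  also have "(\<Prod>p\<in>prime_factors n. p ^ multiplicity p n) = n"
    using assms by (simp add: prime_factorization_nat [symmetric])
  finally show ?thesis .
qed

lemma totient_plus_dedekind_psi_ge:
  assumes "n > 0"
  shows "2 * n \<le> totient n + dedekind_psi n"
proof -
  have "real n * 2 \<le> real n *
      ((\<Prod>p\<in>prime_factors n. 1 - 1 / real p) + (\<Prod>p\<in>prime_factors n. 1 + 1 / real p))"
    by (intro mult_left_mono prod_one_minus_plus_prod_one_plus_ge)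
       (auto dest!: in_prime_factors_imp_prime prime_ge_1_nat)
  also have "\<dots> = real (totient n + dedekind_psi n)"
    by (simp add: totient_formula2 dedekind_psi_real[OF assms] distrib_left)
  finally show ?thesis by linarith
qed

text \<open>Some prime divides n, so the product of the factors 1 + 1/p is nonempty and exceeds
  1.\<close>

lemma dedekind_psi_gt:
  assumes "n \<ge> 2"
  shows "n < dedekind_psi n"
proof -
  have "prime_factors n \<noteq> {}"
    using assms by (auto simp: prime_factorization_empty_iff)
  hence "1 < (\<Prod>p\<in>prime_factors n. 1 + 1 / real p)"
    by (intro less_1_prod) (auto dest!: in_prime_factors_imp_prime prime_gt_0_nat)
  hence "real n * 1 < real n * (\<Prod>p\<in>prime_factors n. 1 + 1 / real p)"
    using assms by (intro mult_strict_left_mono) auto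
  thus ?thesis
    using assms by (simp flip: dedekind_psi_real)
qed

text \<open>Unique factorization: \<open>prime_factors\<close> recovers S from its product and so is
  a left inverse.\<close>

lemma inj_on_prod_primes:
  assumes "\<And>p. p \<in> P \<Longrightarrow> prime (p :: nat)" "finite P"
  shows "inj_on (\<lambda>S. \<Prod>S) (Pow P)"
proof (rule inj_on_inverseI)
  fix S assume S: "S \<in> Pow P"
  hence fin: "finite S" using assms(2) finite_subset by auto
  moreover have "prime p" if "p \<in> S" for p using that S assms(1) by blast
  ultimately have "prime_factorization (prod_mset (mset_set S)) = mset_set S"
    by (intro prime_factorization_prod_mset_primes) simp
  thus "prime_factors (\<Prod>S) = S"
    using fin by (simp add: prod_unfold_prod_mset)
qed

text \<open>Expanding the product over p of (p + 1) writes psi(n) as a sum of distinct divisors of n.\<close>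
lemma dedekind_psi_le_divisor_sum:
  assumes "n > 0"
  shows "dedekind_psi n \<le> divisor_sum n"
proof -
  let ?P = "prime_factors n"
  \<comment> \<open>m is n divided by its radical, the product of the distinct primes dividing
    n.\<close>
  define m where "m = (\<Prod>p\<in>?P. p ^ (multiplicity p n - 1))"
  have n: "n = m * \<Prod>?P"
  proof -
    have "n = (\<Prod>p\<in>?P. p ^ multiplicity p n)"
      using assms by (simp add: prime_factorization_nat [symmetric])
    also have "\<dots> = (\<Prod>p\<in>?P. p ^ (multiplicity p n - 1) * p)"
      by (rule prod.cong) (auto simp: prime_factors_multiplicity simp flip: power_Suc2)
    finally show ?thesis by (simp add: m_def prod.distrib)
  qed
  \<comment> \<open>As n > 0, also m > 0, so m cancels and the subset products remain.\<close>
  have inj: "inj_on (\<lambda>S. m * \<Prod>S) (Pow ?P)"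
    using inj_on_prod_primes[of ?P] n assms by (auto simp: inj_on_def)
  have "dedekind_psi n = m * (\<Prod>p\<in>?P. p + 1)"
    by (simp only: dedekind_psi_def m_def prod.distrib)
  also have "\<dots> = (\<Sum>S\<in>Pow ?P. m * \<Prod>S)"
    by (subst prod_add) (simp_all add: sum_distrib_left)
  also have "\<dots> = \<Sum>((\<lambda>S. m * \<Prod>S) ` Pow ?P)"
    using inj by (simp add: sum.reindex)
  also have "\<dots> \<le> divisor_sum n"
    unfolding divisor_sum_def
  proof (rule sum_mono2)
    show "finite {d. d dvd n}" using assms by simp
    have "m * \<Prod>S dvd n" if "S \<subseteq> ?P" for S
      by (subst n) (intro mult_dvd_mono prod_dvd_prod_subset that, auto)
    thus "(\<lambda>S. m * \<Prod>S) ` Pow ?P \<subseteq> {d. d dvd n}" by blast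
  qed simp
  finally show ?thesis .
qed

theorem theorem1:
  fixes n :: nat
  assumes "n \<ge> 2"
  shows "totient n ^ 3 + dedekind_psi n ^ 3 + divisor_sum n ^ 3
           \<ge> 3 * n ^ 3 + 3 * n ^ 2 + 9 * n + 1"
proof -
  obtain s where s: "dedekind_psi n = n + s" "s \<ge> 1"
    using dedekind_psi_gt[OF assms] by (metis less_iff_Suc_add add_Suc_right le_add1 plus_1_eq_Suc)
  \<comment> \<open>Over the integers N - S is a true difference, even when s > n.\<close>
  define N S where "N = int n" and "S = int s"
  have pos: "N \<ge> 0" "S \<ge> 1" using s by (auto simp: N_def S_def)
  have "N - S \<le> int (totient n)"
    using totient_plus_dedekind_psi_ge[of n] s assms by (simp add: N_def S_def)
  \<comment> \<open>N - S may be negative; cubes are monotone nevertheless.\<close>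
  hence tot: "(N - S) ^ 3 \<le> int (totient n) ^ 3"
    by (intro power_mono_odd) auto
  have "N + S \<le> int (divisor_sum n)"
    using dedekind_psi_le_divisor_sum[of n] s assms by (simp add: N_def S_def)
  hence sig: "(N + S) ^ 3 \<le> int (divisor_sum n) ^ 3"
    using pos by (intro power_mono) auto
  have psi: "int (dedekind_psi n) = N + S" by (simp add: s(1) N_def S_def)
  have "1 \<le> S ^ 2" "1 \<le> S ^ 3" using pos by (auto intro: one_le_power)
  \<comment> \<open>Each power of S is at least 1 and has a nonnegative coefficient, so the
    comparison with S = 1 goes term by term; the factors 1 on the left make the terms match.\<close>
  hence "3 * N ^ 3 + 3 * N ^ 2 * 1 + 9 * N * 1 + 1 \<le> 3 * N ^ 3 + 3 * N ^ 2 * S + 9 * N * S ^ 2 + S ^ 3"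
    using pos by (intro add_mono mult_left_mono order.refl) auto
  also have "\<dots> = (N - S) ^ 3 + (N + S) ^ 3 + (N + S) ^ 3"
    by (simp add: power3_eq_cube power2_eq_square algebra_simps)
  also have "\<dots> \<le> int (totient n) ^ 3 + int (dedekind_psi n) ^ 3 + int (divisor_sum n) ^ 3"
    unfolding psi using tot sig by linarith
  finally have "int (3 * n ^ 3 + 3 * n ^ 2 + 9 * n + 1) \<le>
      int (totient n ^ 3 + dedekind_psi n ^ 3 + divisor_sum n ^ 3)"
    by (simp add: N_def)
  thus ?thesis by (simp only: of_nat_le_iff)
qed

end
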